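(* For every $\epsilon>0$ there exist a tile counting function $f\in\mathcal{F}$ and a real number $A\in(1-\epsilon,1+\epsilon)$ such that $f(n)\sim A\cdot C_n$ as $n\to\infty$, where $C_n=\frac{1}{n+1}\binom{2n}{n}$ is the $n$-th Catalan number.
   Context: $\mathbb{N}=\{0,1,2,\ldots\}$; $f\sim g$ means $f(n)/g(n)\to 1$ as $n\to\infty$. Tile counting functions: A tile is an axis-parallel simply connected closed polygon in $\mathbb{R}^2$ (side lengths may be irrational); tiles are considered up to translation. A tile is tall if it has height exactly $1$. For real $a\ge 0$ let $R_a=[1\times a]$ be the rectangle of height $1$ and length $a$. A tiling of $R_a$ with a finite set of tiles $T$ is a collection of translates of tiles of $T$ (no rotations or reflections) with pairwise disjoint interiors whose union is $R_a$ (for $a=0$ the only tiling is the empty one). For a finite set $T$ of tall tiles and a fixed real $\varepsilon\ge 0$, let $f_{T,\varepsilon}(n)$ be the number of tilings of $R_{n+\varepsilon}$ with $T$, $n\in\mathbb{N}$. $\mathcal{F}$ denotes the set of all functions $f_{T,\varepsilon}:\mathbb{N}\to\mathbb{N}$ obtained in this way (the parameter $\varepsilon$ here is unrelated to $\epsilon$ in the claim). *)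

theory Defs
  imports "HOL-Analysis.Analysis"
begin

text \<open>
  A closed axis-parallel polygon, possibly with holes, is a finite union of non-degenerate
  axis-parallel closed rectangles. Requiring the interior to be connected excludes unions whose
  pieces meet only in isolated points, such as two squares sharing just a corner.
\<close>
definition axis_parallel_polygon :: "(real \<times> real) set \<Rightarrow> bool" where
  "axis_parallel_polygon S \<longleftrightarrow>
     (\<exists>\<R>. finite \<R> \<and> \<R> \<noteq> {} \<and>
        (\<forall>R\<in>\<R>. \<exists>a b c d. a < b \<and> c < d \<and> R = {a..b} \<times> {c..d}) \<and>
        S = \<Union>\<R> \<and> connected (interior S))"

definition tile :: "(real \<times> real) set \<Rightarrow> bool" where
  "tile S \<longleftrightarrow> axis_parallel_polygon S \<and> simply_connected S"

definition height :: "(real \<times> real) set \<Rightarrow> real" where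
  "height S = Sup (snd ` S) - Inf (snd ` S)"

definition tall :: "(real \<times> real) set \<Rightarrow> bool" where
  "tall S \<longleftrightarrow> height S = 1"

definition strip :: "real \<Rightarrow> (real \<times> real) set" where
  "strip a = {0..a} \<times> {0..1}"

text \<open>
  A tiling is the set of its placed tiles. It therefore depends on the tiles in \<open>T\<close> only up to
  translation: replacing a member of \<open>T\<close> by a translate, or adding a translate of a member,
  changes nothing. The case \<open>a = 0\<close> is separate because the degenerate rectangle \<open>strip 0\<close> is a
  non-empty segment, whereas its only tiling is by convention the empty one.
\<close>
definition tilings :: "(real \<times> real) set set \<Rightarrow> real \<Rightarrow> (real \<times> real) set set set" where
  "tilings T a =
     (if a = 0 then {{}}
      else {P. (\<forall>p\<in>P. \<exists>t\<in>T. \<exists>v. p = (+) v ` t) \<and>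
               pairwise (\<lambda>p q. interior p \<inter> interior q = {}) P \<and>
               \<Union>P = strip a})"

text \<open>
  For a finite set of tiles there are only finitely many tilings (the lexicographically least
  point not yet covered determines the position of the tile placed there), so \<open>card\<close> counts them.
\<close>
definition tile_count :: "(real \<times> real) set set \<Rightarrow> real \<Rightarrow> nat \<Rightarrow> nat" where
  "tile_count T \<epsilon> n = card (tilings T (real n + \<epsilon>))"

definition tile_counting_functions :: "(nat \<Rightarrow> nat) set" where
  "tile_counting_functions =
     {tile_count T \<epsilon> | T \<epsilon>. finite T \<and> (\<forall>t\<in>T. tile t \<and> tall t) \<and> 0 \<le> \<epsilon>}"

definition catalan :: "nat \<Rightarrow> real" where
  "catalan n = 1 / (real n + 1) * real ((2 * n) choose n)"

end

theory Submission
  imports Defs "HOL-Combinatorics.Multiset_Permutations" "HOL-Real_Asymp.Real_Asymp"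
begin

text \<open>
  All tiles are rectangles of height 1, so tilings are words over a finite set of lengths. Six
  lengths and the lengths of the marker letters are chosen such that, by linear independence over
  the rationals of 1 and the binary logarithms of the odd primes up to 17, a word of total length
  \<open>n + log 2 (17/16)\<close> contains exactly one marker, and the marker determines how often the other
  six letters occur: nearly \<open>2m, 2m, m, m, m, m\<close> times, where \<open>n\<close> is about \<open>10m\<close>. These
  multiplicities make the number of words comparable to \<open>m\<close> times the multinomial coefficient
  \<open>(8m)! / ((2m)!\<^sup>2 m!\<^sup>4)\<close>, which is a product of five central binomial coefficients and hence of
  order \<open>m * 4 ^ (10m) / m powr (5/2)\<close>, the order of the Catalan number at \<open>10m\<close>.
  Ten classes of markers, one for each residue of \<open>n\<close> modulo 10, with \<open>N\<close> markers each whose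
  length is shifted by \<open>K\<close>, give \<open>A = N * B / 4 ^ K\<close> with a fixed \<open>B > 0\<close>; these values are dense.
\<close>

subsection \<open>Tilings by rectangles as words\<close>

definition words :: "real set \<Rightarrow> real \<Rightarrow> real list set" where
  "words L a = {xs. set xs \<subseteq> L \<and> sum_list xs = a}"

definition piece :: "real \<Rightarrow> real \<Rightarrow> (real \<times> real) set" where
  "piece x y = {x..y} \<times> {0..1}"

text \<open>The left end \<open>s\<close> is a parameter so that removing the leftmost piece leaves
  an object of the same kind. The case \<open>s = b\<close> mirrors the convention for length 0 in
  \<open>tilings\<close>.\<close>

definition piece_tilings :: "real set \<Rightarrow> real \<Rightarrow> real \<Rightarrow> (real \<times> real) set set set" where
  "piece_tilings L s b =
     (if s = b then {{}}
      else {P. (\<forall>p\<in>P. \<exists>l\<in>L. \<exists>x. p = piece x (x + l)) \<and>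
               pairwise (\<lambda>p q. interior p \<inter> interior q = {}) P \<and> \<Union>P = piece s b})"

lemma interior_piece: "interior (piece x y) = {x<..<y} \<times> {0<..<1}"
  by (simp add: piece_def interior_Times)

lemma piece_subset_iff: "x \<le> y \<Longrightarrow> piece x y \<subseteq> piece s b \<longleftrightarrow> s \<le> x \<and> y \<le> b"
  by (auto simp: piece_def times_subset_iff)

lemma piece_eq_iff: "x \<le> y \<Longrightarrow> x' \<le> y' \<Longrightarrow> piece x y = piece x' y' \<longleftrightarrow> x = x' \<and> y = y'"
  using piece_subset_iff[of x y x' y'] piece_subset_iff[of x' y' x y] by auto

lemma interior_piece_disjoint_iff:
  assumes "x < y" "x' < y'"
  shows "interior (piece x y) \<inter> interior (piece x' y') = {} \<longleftrightarrow> y \<le> x' \<or> y' \<le> x"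
proof -
  have "{0<..<1::real} \<noteq> {}" by simp
  then have "interior (piece x y) \<inter> interior (piece x' y') = {} \<longleftrightarrow> {x<..<y} \<inter> {x'<..<y'} = {}"
    unfolding interior_piece Times_Int_Times by (simp only: Times_empty Int_absorb) simp
  also have "{x<..<y} \<inter> {x'<..<y'} = {max x x'<..<min y y'}" by auto
  also have "\<dots> = {} \<longleftrightarrow> y \<le> x' \<or> y' \<le> x"
    using assms by (auto simp: greaterThanLessThan_empty_iff max_def min_def split: if_splits)
  finally show ?thesis .
qed

text \<open>The piece covering \<open>(s, 0)\<close> cannot protrude to the left, so it begins at
  \<open>s\<close>, and every other piece lies to the right of its end. The delicate point is that
  the remaining pieces still cover the vertical edge at \<open>s + l\<close>.\<close>

lemma piece_tilings_peel:
  assumes L: "0 < \<delta>" "\<And>l. l \<in> L \<Longrightarrow> \<delta> \<le> l" and "s < b" and P: "P \<in> piece_tilings L s b"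
  obtains l where "l \<in> L" "s + l \<le> b" "piece s (s + l) \<in> P"
    "P - {piece s (s + l)} \<in> piece_tilings L (s + l) b"
proof -
  from P \<open>s < b\<close> have pieces: "\<And>p. p \<in> P \<Longrightarrow> \<exists>l\<in>L. \<exists>x. p = piece x (x + l)"
    and disj: "pairwise (\<lambda>p q. interior p \<inter> interior q = {}) P" and cover: "\<Union>P = piece s b"
    by (auto simp: piece_tilings_def)
  have pos: "0 < l" if "l \<in> L" for l using L that by force
  have inside: "s \<le> x \<and> x + l \<le> b" if "piece x (x + l) \<in> P" "l \<in> L" for x l
    using that cover pos[of l] piece_subset_iff[of x "x + l" s b] by auto
  have sep: "x + l \<le> y \<or> y + k \<le> x"
    if "piece x (x + l) \<in> P" "l \<in> L" "piece y (y + k) \<in> P" "k \<in> L" "x \<noteq> y" for x l y k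
  proof -
    have "piece x (x + l) \<noteq> piece y (y + k)"
      using that pos piece_eq_iff[of x "x + l" y "y + k"] by (auto simp: less_imp_le)
    then show ?thesis
      using disj that pos interior_piece_disjoint_iff[of x "x + l" y "y + k"]
      by (auto simp: pairwise_def)
  qed
  have find: "\<exists>x l. l \<in> L \<and> piece x (x + l) \<in> P \<and> x \<le> z \<and> z \<le> x + l" if "s \<le> z" "z \<le> b" for z
  proof -
    have "(z, 0) \<in> \<Union>P" using that by (simp add: cover piece_def)
    then obtain p where "p \<in> P" "(z, 0) \<in> p" by auto
    moreover obtain l x where "l \<in> L" "p = piece x (x + l)" using pieces \<open>p \<in> P\<close> by blast
    ultimately show ?thesis by (intro exI[of _ x] exI[of _ l]) (auto simp: piece_def)
  qed
  obtain x l where l: "l \<in> L" "piece x (x + l) \<in> P" "x \<le> s"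
    using find[of s] \<open>s < b\<close> by auto
  with inside have x: "x = s" by force
  have sl: "s + l \<le> b" "piece s (s + l) \<in> P" using inside l x by auto
  have right: "s + l \<le> y" if "piece y (y + k) \<in> P" "k \<in> L" "piece y (y + k) \<noteq> piece s (s + l)" for y k
  proof (cases "y = s")
    case True
    have "k \<noteq> l" using that True by auto
    then have "interior (piece y (y + k)) \<inter> interior (piece s (s + l)) = {}"
      using disj that sl by (auto simp: pairwise_def)
    then show ?thesis
      using that l pos[of k] pos[of l] True interior_piece_disjoint_iff[of y "y + k" s "s + l"] by auto
  next
    case False
    then show ?thesis using sep[of s l y k] that sl l inside[of y k] pos[of k] by auto
  qed
  have "P - {piece s (s + l)} \<in> piece_tilings L (s + l) b"
  proof (cases "s + l = b")
    case True
    have "q = piece s (s + l)" if "q \<in> P" for q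
    proof (rule ccontr)
      assume "q \<noteq> piece s (s + l)"
      moreover obtain y k where "q = piece y (y + k)" "k \<in> L" using pieces \<open>q \<in> P\<close> by blast
      ultimately show False using right[of y k] inside[of y k] pos[of k] True that by auto
    qed
    then show ?thesis using True by (auto simp: piece_tilings_def)
  next
    case False
    with sl have lt: "s + l < b" by simp
    \<comment> \<open>Points of the edge at \<open>s + l\<close> might be covered by the removed
      piece only, so a piece beginning exactly there is needed. Choose \<open>z\<close> less than
      \<delta> to the right of \<open>s + l\<close>. If the piece over \<open>z\<close> began at
      some \<open>y > s + l\<close>, a further piece of length at least \<delta> would have to fit
      between \<open>s + l\<close> and \<open>y\<close>.\<close>
    have start: "\<exists>k. k \<in> L \<and> piece (s + l) (s + l + k) \<in> P"
    proof -
      define z where "z = s + l + min \<delta> (b - (s + l)) / 2"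
      have z: "s + l < z" "z \<le> b" "z < s + l + \<delta>" using lt L(1) by (auto simp: z_def min_def field_simps)
      obtain y k where y: "k \<in> L" "piece y (y + k) \<in> P" "y \<le> z" "z \<le> y + k"
        using find[of z] z pos[OF l(1)] by auto
      have ne: "piece y (y + k) \<noteq> piece s (s + l)"
        using piece_eq_iff[of y "y + k" s "s + l"] pos y z l by force
      have ge: "s + l \<le> y" using right[OF y(2,1) ne] .
      show ?thesis
      proof (cases "y = s + l")
        case True
        then show ?thesis using y by auto
      next
        case False
        define w where "w = (s + l + y) / 2"
        have w: "s + l < w" "w < y" using ge False by (auto simp: w_def)
        obtain y' k' where y': "k' \<in> L" "piece y' (y' + k') \<in> P" "y' \<le> w" "w \<le> y' + k'"
          using find[of w] w z y pos[OF l(1)] by force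
        have "piece y' (y' + k') \<noteq> piece s (s + l)"
          using piece_eq_iff[of y' "y' + k'" s "s + l"] pos y' w l by force
        then have "s + l \<le> y'" using right y' by blast
        moreover have "y' + k' \<le> y"
          using sep[OF y'(2,1) y(2,1)] w y' pos[OF y(1)] by auto
        ultimately show ?thesis using L(2)[OF y'(1)] z y by auto
      qed
    qed
    have "\<Union>(P - {piece s (s + l)}) = piece (s + l) b"
    proof (intro equalityI subsetI)
      fix v assume "v \<in> \<Union>(P - {piece s (s + l)})"
      then obtain q where q: "q \<in> P" "q \<noteq> piece s (s + l)" "v \<in> q" by auto
      obtain y k where y: "q = piece y (y + k)" "k \<in> L" using pieces q by blast
      have "q \<subseteq> piece (s + l) b"
        using right[of y k] inside[of y k] q y pos[of k] piece_subset_iff[of y "y + k" "s + l" b] by auto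
      then show "v \<in> piece (s + l) b" using q by auto
    next
      fix v assume v: "v \<in> piece (s + l) b"
      show "v \<in> \<Union>(P - {piece s (s + l)})"
      proof (cases "fst v = s + l")
        case True
        obtain k where k: "k \<in> L" "piece (s + l) (s + l + k) \<in> P" using start by auto
        have "piece (s + l) (s + l + k) \<noteq> piece s (s + l)"
          using piece_eq_iff[of "s + l" "s + l + k" s "s + l"] pos k l by (auto simp: less_imp_le)
        moreover have "v \<in> piece (s + l) (s + l + k)"
          using v True pos[OF k(1)] by (cases v) (auto simp: piece_def)
        ultimately show ?thesis using k by auto
      next
        case False
        have "v \<in> \<Union>P" using v pos[OF l(1)] by (cases v) (auto simp: cover piece_def)
        moreover have "v \<notin> piece s (s + l)" using v False by (cases v) (auto simp: piece_def)
        ultimately show ?thesis by auto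
      qed
    qed
    then show ?thesis
      using False pieces disj by (auto simp: piece_tilings_def pairwise_def)
  qed
  with sl l that show thesis by blast
qed

lemma Union_piece_tilings:
  "P \<in> piece_tilings L s b \<Longrightarrow> \<Union>P \<subseteq> piece s b"
  by (auto simp: piece_tilings_def split: if_splits)

text \<open>The point \<open>(s, 0)\<close> lies to the left of everything that \<open>P\<close>
  covers. This makes inserting the first piece injective and keeps tilings with different first
  pieces apart.\<close>

lemma piece_notin_piece_tilings:
  assumes "0 < l" "P \<in> piece_tilings L (s + l) b" "s \<le> x"
  shows "piece s x \<notin> P"
proof
  assume "piece s x \<in> P"
  moreover have "(s, 0) \<in> piece s x" using assms(3) by (auto simp: piece_def)
  ultimately have "(s, 0) \<in> \<Union>P" by blast
  then show False using Union_piece_tilings[OF assms(2)] assms(1) by (auto simp: piece_def)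
qed

lemma piece_tilings_insert:
  assumes "\<And>l. l \<in> L \<Longrightarrow> 0 < l" "l \<in> L" "s + l \<le> b" "P \<in> piece_tilings L (s + l) b"
  shows "insert (piece s (s + l)) P \<in> piece_tilings L s b"
proof -
  have l: "0 < l" using assms by auto
  have un: "piece s (s + l) \<union> piece (s + l) b = piece s b" using l assms(3) by (auto simp: piece_def)
  have disj: "interior (piece s (s + l)) \<inter> interior q = {}" if "q \<in> P" for q
  proof -
    have "q \<subseteq> piece (s + l) b" using Union_piece_tilings[OF assms(4)] that by auto
    then have "interior q \<subseteq> interior (piece (s + l) b)" by (rule interior_mono)
    then show ?thesis by (auto simp: interior_piece)
  qed
  show ?thesis
  proof (cases "s + l = b")
    case True
    then have "P = {}" using assms(4) by (auto simp: piece_tilings_def)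
    then show ?thesis using True l assms(2) by (auto simp: piece_tilings_def pairwise_def)
  next
    case False
    then have P: "\<forall>p\<in>P. \<exists>l\<in>L. \<exists>x. p = piece x (x + l)"
      "pairwise (\<lambda>p q. interior p \<inter> interior q = {}) P" "\<Union>P = piece (s + l) b"
      using assms(4) by (auto simp: piece_tilings_def)
    have "pairwise (\<lambda>p q. interior p \<inter> interior q = {}) (insert (piece s (s + l)) P)"
      using P(2) disj by (auto simp: pairwise_insert)
    moreover have "s \<noteq> b" using l assms(3) by auto
    ultimately show ?thesis using P un assms(2) by (auto simp: piece_tilings_def)
  qed
qed

lemma piece_tilings_rec:
  assumes "0 < \<delta>" "\<And>l. l \<in> L \<Longrightarrow> \<delta> \<le> l" "s < b"
  shows "piece_tilings L s b =
    (\<Union>l\<in>{l\<in>L. s + l \<le> b}. insert (piece s (s + l)) ` piece_tilings L (s + l) b)"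
proof (intro equalityI subsetI)
  fix P assume "P \<in> piece_tilings L s b"
  then obtain l where l: "l \<in> L" "s + l \<le> b" "piece s (s + l) \<in> P"
    "P - {piece s (s + l)} \<in> piece_tilings L (s + l) b"
    using piece_tilings_peel[of \<delta> L s b P] assms by blast
  then have "P = insert (piece s (s + l)) (P - {piece s (s + l)})" by auto
  then show "P \<in> (\<Union>l\<in>{l\<in>L. s + l \<le> b}. insert (piece s (s + l)) ` piece_tilings L (s + l) b)"
    using l by blast
next
  fix P assume "P \<in> (\<Union>l\<in>{l\<in>L. s + l \<le> b}. insert (piece s (s + l)) ` piece_tilings L (s + l) b)"
  moreover have "0 < l" if "l \<in> L" for l using assms that by force
  ultimately show "P \<in> piece_tilings L s b"
    using piece_tilings_insert[of L _ s b] by blast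
qed

lemma words_rec:
  assumes "\<And>l. l \<in> L \<Longrightarrow> 0 < l" "0 < a"
  shows "words L a = (\<Union>l\<in>{l\<in>L. l \<le> a}. (#) l ` words L (a - l))"
proof (intro equalityI subsetI)
  fix xs assume xs: "xs \<in> words L a"
  then obtain l ys where ys: "xs = l # ys" using assms(2) by (cases xs) (auto simp: words_def)
  have "0 \<le> sum_list ys" using xs assms(1) by (intro sum_list_nonneg) (auto simp: words_def ys intro: less_imp_le)
  then show "xs \<in> (\<Union>l\<in>{l\<in>L. l \<le> a}. (#) l ` words L (a - l))"
    using xs by (auto simp: words_def ys)
qed (auto simp: words_def)

text \<open>Tilings and words obey the same recursion on the first piece or letter, and both unions
  are disjoint. The induction is on a bound \<open>m\<close> for \<open>(b - s) / \<delta>\<close>,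
  where \<delta> is a lower bound for the lengths; finiteness is carried along because the
  cardinality of a disjoint union requires it.\<close>

lemma card_piece_tilings:
  assumes "finite L" "\<And>l. l \<in> L \<Longrightarrow> 0 < l" "s \<le> b"
  shows "card (piece_tilings L s b) = card (words L (b - s))"
proof -
  obtain \<delta> where \<delta>: "0 < \<delta>" "\<And>l. l \<in> L \<Longrightarrow> \<delta> \<le> l"
  proof (cases "L = {}")
    case True
    then show ?thesis using that[of 1] by auto
  next
    case False
    then show ?thesis using that[of "Min L"] assms by auto
  qed
  have "finite (piece_tilings L s b) \<and> finite (words L (b - s)) \<and>
      card (piece_tilings L s b) = card (words L (b - s))"
    if "b - s < real m * \<delta>" for m using that assms(3)
  proof (induction m arbitrary: s)
    case (Suc m)
    show ?case
    proof (cases "s = b")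
      case True
      have "words L 0 = {[]}"
      proof -
        have "xs = []" if "set xs \<subseteq> L" "sum_list xs = 0" for xs
        proof (cases xs)
          case (Cons x ys)
          have "0 \<le> sum_list ys" using that assms(2) Cons by (intro sum_list_nonneg) (auto intro: less_imp_le)
          then show ?thesis using that assms(2)[of x] Cons by auto
        qed auto
        then show ?thesis by (auto simp: words_def)
      qed
      then show ?thesis using True by (simp add: piece_tilings_def)
    next
      case False
      with Suc.prems have "s < b" by simp
      let ?K = "{l\<in>L. s + l \<le> b}"
      have fin: "finite ?K" using assms by simp
      have tilings_eq: "piece_tilings L s b = (\<Union>l\<in>?K. insert (piece s (s + l)) ` piece_tilings L (s + l) b)"
        by (rule piece_tilings_rec[OF \<delta> \<open>s < b\<close>])
      have "{l \<in> L. l \<le> b - s} = ?K" by auto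
      then have words_eq: "words L (b - s) = (\<Union>l\<in>?K. (#) l ` words L (b - s - l))"
        using words_rec[of L "b - s"] assms(2) \<open>s < b\<close> by simp
      have IH: "finite (piece_tilings L (s + l) b)" "finite (words L (b - s - l))"
        "card (piece_tilings L (s + l) b) = card (words L (b - s - l))" if "l \<in> ?K" for l
      proof -
        have "b - (s + l) < real m * \<delta>" using Suc.prems \<delta>(2)[of l] that by (auto simp: algebra_simps)
        from Suc.IH[OF this] that
        show "finite (piece_tilings L (s + l) b)" "finite (words L (b - s - l))"
          "card (piece_tilings L (s + l) b) = card (words L (b - s - l))"
          by (auto simp: algebra_simps)
      qed
      have notin: "piece s (s + k) \<notin> P" if "l \<in> ?K" "k \<in> ?K" "P \<in> piece_tilings L (s + l) b" for l k P
        using piece_notin_piece_tilings[of l P L s b "s + k"] that assms(2)[of l] assms(2)[of k] by auto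
      have inj: "inj_on (insert (piece s (s + l))) (piece_tilings L (s + l) b)" if "l \<in> ?K" for l
        using notin[OF that that] by (intro inj_onI) (metis insert_ident)
      have "insert (piece s (s + l)) ` piece_tilings L (s + l) b \<inter>
          insert (piece s (s + k)) ` piece_tilings L (s + k) b = {}"
        if "l \<in> ?K" "k \<in> ?K" "l \<noteq> k" for l k
      proof -
        have "piece s (s + l) \<noteq> piece s (s + k)"
          using that piece_eq_iff[of s "s + l" s "s + k"] assms(2)[of l] assms(2)[of k] by auto
        then have "insert (piece s (s + l)) P \<noteq> insert (piece s (s + k)) Q"
          if "P \<in> piece_tilings L (s + l) b" "Q \<in> piece_tilings L (s + k) b" for P Q
          using notin[OF \<open>l \<in> ?K\<close> \<open>k \<in> ?K\<close> that(1)] by blast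
        then show ?thesis by blast
      qed
      then have "card (piece_tilings L s b) = (\<Sum>l\<in>?K. card (piece_tilings L (s + l) b))"
        unfolding tilings_eq using fin IH inj
        by (subst card_UN_disjoint) (auto simp: card_image intro!: sum.cong)
      moreover have "card (words L (b - s)) = (\<Sum>l\<in>?K. card (words L (b - s - l)))"
        unfolding words_eq using fin IH
        by (subst card_UN_disjoint) (auto simp: card_image intro!: sum.cong)
      moreover have "finite (piece_tilings L s b)"
        unfolding tilings_eq using fin IH by auto
      moreover have "finite (words L (b - s))"
        unfolding words_eq using fin IH by auto
      ultimately show ?thesis using IH by simp
    qed
  qed auto
  moreover obtain m where "b - s < real m * \<delta>"
    using reals_Archimedean3[OF \<delta>(1)] by blast
  ultimately show ?thesis by blast
qed

section \<open>Rectangles as tall tiles\<close>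

lemma tile_strip: "0 < l \<Longrightarrow> tile (strip l)"
proof -
  assume l: "0 < l"
  have "convex (interior (strip l))"
    by (intro convex_interior) (auto simp: strip_def intro!: convex_Times)
  then have "axis_parallel_polygon (strip l)" unfolding axis_parallel_polygon_def
  proof (intro exI[of _ "{strip l}"] conjI ballI)
    fix R assume "R \<in> {strip l}"
    then show "\<exists>a b c d. a < b \<and> c < d \<and> R = {a..b} \<times> {c..d}"
      using l by (intro exI[of _ 0] exI[of _ l] exI[of _ 1]) (auto simp: strip_def)
  qed (auto intro: convex_connected)
  moreover have "simply_connected (strip l)"
    by (intro convex_imp_simply_connected) (auto simp: strip_def intro!: convex_Times)
  ultimately show ?thesis by (simp add: tile_def)
qed

lemma tall_strip: "0 < l \<Longrightarrow> tall (strip l)"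
proof -
  assume "0 < l"
  then have "snd ` strip l = {0..1}" by (auto simp: strip_def image_iff)
  then show ?thesis by (simp add: tall_def height_def)
qed

lemma strip_translate_eq: "(+) (x, 0) ` strip l = piece x (x + l)"
proof -
  have "(u, v) \<in> (+) (x, 0) ` strip l" if "(u, v) \<in> piece x (x + l)" for u v
    using that by (intro image_eqI[of _ _ "(u - x, v)"]) (auto simp: strip_def piece_def)
  then show ?thesis by (auto simp: strip_def piece_def)
qed

lemma card_tilings_strips:
  assumes "finite L" "\<And>l. l \<in> L \<Longrightarrow> 0 < l" "0 < a"
  shows "card (tilings (strip ` L) a) = card (words L a)"
proof -
  have st: "strip a = piece 0 a" by (simp add: strip_def piece_def)
  have eqv: "(\<forall>p\<in>P. \<exists>t\<in>strip ` L. \<exists>v. p = (+) v ` t) \<longleftrightarrow> (\<forall>p\<in>P. \<exists>l\<in>L. \<exists>x. p = piece x (x + l))"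
    (is "?A \<longleftrightarrow> ?B") if "\<Union>P = strip a" for P
  proof
    assume ?B
    then show ?A by (metis imageI strip_translate_eq)
  next
    assume ?A
    show ?B
    proof
      fix p assume "p \<in> P"
      with \<open>?A\<close> obtain l x y where l: "l \<in> L" "p = (+) (x, y) ` strip l" by (metis image_iff surj_pair)
      \<comment> \<open>A translate may have a vertical component \<open>y\<close> a priori. Both
        ends of its left edge, which has length 1, stay inside the strip of height 1, and this
        forces \<open>y = 0\<close>.\<close>
      have "(0, 0) \<in> strip l" "(0, 1) \<in> strip l" using assms(2)[OF l(1)] by (auto simp: strip_def)
      then have "(x, y) + (0, 0) \<in> p" "(x, y) + (0, 1) \<in> p" unfolding l(2) by (blast intro: imageI)+
      moreover have "p \<subseteq> strip a" using that \<open>p \<in> P\<close> by auto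
      ultimately have "(x, y) \<in> strip a" "(x, y + 1) \<in> strip a" by auto
      then have "y = 0" by (auto simp: strip_def)
      then show "\<exists>l\<in>L. \<exists>x. p = piece x (x + l)" using l strip_translate_eq by auto
    qed
  qed
  have "tilings (strip ` L) a = piece_tilings L 0 a"
    unfolding tilings_def piece_tilings_def st[symmetric] if_not_P[OF less_imp_neq[OF assms(3)]]
      if_not_P[OF less_imp_neq[OF assms(3), symmetric]]
  proof (rule Collect_cong)
    show "(\<forall>p\<in>P. \<exists>t\<in>strip ` L. \<exists>v. p = (+) v ` t) \<and>
        pairwise (\<lambda>p q. interior p \<inter> interior q = {}) P \<and> \<Union>P = strip a \<longleftrightarrow>
      (\<forall>p\<in>P. \<exists>l\<in>L. \<exists>x. p = piece x (x + l)) \<and>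
        pairwise (\<lambda>p q. interior p \<inter> interior q = {}) P \<and> \<Union>P = strip a" for P
      by (cases "\<Union>P = strip a") (simp_all only: eqv simp_thms)
  qed
  then show ?thesis using card_piece_tilings[of L 0 a] assms by simp
qed

subsection \<open>Asymptotics of multinomial coefficients\<close>

definition cb :: "nat \<Rightarrow> real" where "cb n = real ((2 * n) choose n)"

lemma cb_fact: "cb n = fact (2 * n) / (fact n) ^ 2"
  unfolding cb_def by (subst binomial_fact) (auto simp: power2_eq_square)

lemma cb_pos: "cb n > 0" by (simp add: cb_def)

lemma cb_Suc: "cb (Suc n) * (real n + 1) = cb n * (2 * (2 * real n + 1))"
proof -
  define f g :: real where "f = fact n" and "g = fact (2 * n)"
  have "f > 0" by (simp add: f_def)
  have "cb (Suc n) = (2 * real n + 2) * ((2 * real n + 1) * g) / ((real n + 1) * f)\<^sup>2"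
    by (simp add: cb_fact f_def g_def algebra_simps)
  moreover have "cb n = g / f\<^sup>2" by (simp add: cb_fact f_def g_def)
  moreover have "(2 * x) * ((2 * x - 1) * g) / (x * f)\<^sup>2 * x = g / f\<^sup>2 * (2 * (2 * x - 1))" if "x > 0" for x
    using that \<open>f > 0\<close> by (simp add: field_simps power2_eq_square)
  from this[of "real n + 1"] have "(2 * real n + 2) * ((2 * real n + 1) * g) / ((real n + 1) * f)\<^sup>2 * (real n + 1) =
      g / f\<^sup>2 * (2 * (2 * real n + 1))" by (simp add: algebra_simps)
  ultimately show ?thesis by simp
qed

text \<open>Wallis' product in disguise: the identity \<open>eq\<close> expresses the partial
  products exactly through squares of \<open>cb n / 4 ^ n\<close>. The limit obtained is
  \<open>1 / sqrt pi\<close>.\<close>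

lemma central_binomial_asymp:
  obtains \<kappa> :: real where "\<kappa> > 0" "(\<lambda>n. cb n * sqrt (real n) / 4 ^ n) \<longlonglongrightarrow> \<kappa>"
proof -
  let ?W = "\<lambda>n. \<Prod>k=1..n. (4*real k^2) / (4*real k^2 - 1)"
  have eq: "?W n * (cb n / 4 ^ n)\<^sup>2 * (2 * real n + 1) = 1" for n
  proof (induction n)
    case (Suc n)
    have a: "(4 * real (Suc n) ^ 2 - 1) = (2 * real n + 1) * (2 * real n + 3)"
      by (simp add: power2_eq_square algebra_simps)
    have c: "cb (Suc n) = cb n * (2 * (2 * real n + 1)) / (real n + 1)"
      using cb_Suc[of n] by (simp add: field_simps)
    have W: "?W (Suc n) = ?W n * ((4 * (real n + 1)^2) / ((2 * real n + 1) * (2 * real n + 3)))"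
      by (subst prod.nat_ivl_Suc') (simp_all only: a, simp_all add: add_ac mult_ac)
    have c': "cb (Suc n) / 4 ^ Suc n = cb n / 4 ^ n * ((2 * (2 * real n + 1)) / (real n + 1) / 4)"
      by (simp add: c)
    have "w * t * (c * d)\<^sup>2 * y = w * c\<^sup>2 * z * (t * d\<^sup>2 * y / z)" if "z \<noteq> 0" for w t c d y z :: real
      using that by (simp add: power_mult_distrib)
    note rearrange = this
    have "?W (Suc n) * (cb (Suc n) / 4 ^ Suc n)\<^sup>2 * (2 * real (Suc n) + 1) =
      ?W n * (cb n / 4 ^ n)\<^sup>2 * (2 * real n + 1) *
        ((4 * (real n + 1)^2) / ((2 * real n + 1) * (2 * real n + 3)) * ((2 * (2 * real n + 1)) / (real n + 1) / 4)\<^sup>2 * (2 * real (Suc n) + 1) / (2 * real n + 1))"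
      unfolding W c' by (rule rearrange) simp
    \<comment> \<open>The new Wallis factor cancels exactly against the squared ratio of consecutive
      central binomial coefficients and the change of \<open>2 * n + 1\<close>.\<close>
    also have "(4 * (real n + 1)^2) / ((2 * real n + 1) * (2 * real n + 3)) * ((2 * (2 * real n + 1)) / (real n + 1) / 4)\<^sup>2 * (2 * real (Suc n) + 1) / (2 * real n + 1) = 1"
    proof -
      have "4 * x\<^sup>2 / ((2 * x - 1) * (2 * x + 1)) * (2 * (2 * x - 1) / x / 4)\<^sup>2 * (2 * x + 1) / (2 * x - 1) = 1"
        if "x \<noteq> 0" "2 * x - 1 \<noteq> 0" "2 * x + 1 \<noteq> 0" for x :: real
        using that by (simp add: power2_eq_square divide_simps) (simp add: algebra_simps)
      from this[of "real n + 1"] show ?thesis by (simp add: add_ac)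
    qed
    finally show ?case by (simp only: mult_1_right Suc.IH)
  qed (simp add: cb_def)
  have "(\<lambda>n. inverse (?W n) * (real n / (2 * real n + 1))) \<longlonglongrightarrow> inverse (pi / 2) * (1 / 2)"
    by (intro tendsto_mult tendsto_inverse wallis) (simp, real_asymp)
  also have "(\<lambda>n. inverse (?W n) * (real n / (2 * real n + 1))) = (\<lambda>n. (cb n * sqrt (real n) / 4 ^ n)\<^sup>2)"
  proof
    fix n
    have "?W n \<noteq> 0" using eq[of n] by (metis mult_zero_left zero_neq_one)
    then show "inverse (?W n) * (real n / (2 * real n + 1)) = (cb n * sqrt (real n) / 4 ^ n)\<^sup>2"
    proof -
      have "inverse w * (real n / z) = c * real n" if "w * c * z = 1" "w \<noteq> 0" "z \<noteq> 0" for w c z :: real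
        using that by (simp add: field_simps)
      from this[OF eq[of n] \<open>?W n \<noteq> 0\<close>]
      have "inverse (?W n) * (real n / (2 * real n + 1)) = (cb n / 4 ^ n)\<^sup>2 * real n" by linarith
      then show ?thesis by (simp only: power_mult_distrib power_divide) simp
    qed
  qed
  finally have "(\<lambda>n. sqrt ((cb n * sqrt (real n) / 4 ^ n)\<^sup>2)) \<longlonglongrightarrow> sqrt (inverse (pi / 2) * (1 / 2))"
    by (rule tendsto_real_sqrt)
  then have "(\<lambda>n. cb n * sqrt (real n) / 4 ^ n) \<longlonglongrightarrow> sqrt (inverse (pi / 2) * (1 / 2))"
    using cb_pos by (simp add: less_imp_le)
  then show ?thesis by (intro that) auto
qed

section \<open>Multinomial coefficients with shifted entries\<close>

lemma fact_add_asymp: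
  "(\<lambda>x. fact (x + a) / (fact x * real x ^ a)) \<longlonglongrightarrow> 1"
proof (induction a)
  case (Suc a)
  have "(\<lambda>x. fact (x + a) / (fact x * real x ^ a) * (real (x + a + 1) / real x)) \<longlonglongrightarrow> 1 * 1"
    by (intro tendsto_mult Suc.IH) real_asymp
  then show ?case by (simp add: algebra_simps)
qed (simp)

lemma fact_diff_asymp:
  "(\<lambda>x. fact (x - a) * real x ^ a / fact x) \<longlonglongrightarrow> 1"
proof -
  \<comment> \<open>Evaluating at \<open>x + a\<close> avoids truncated subtraction; the offset is
    removed at the end.\<close>
  have "(\<lambda>x. inverse (fact (x + a) / (fact x * real x ^ a)) * (real (x + a) / real x) ^ a) \<longlonglongrightarrow> inverse 1 * 1 ^ a"
    by (intro tendsto_mult tendsto_inverse fact_add_asymp tendsto_power) (simp, real_asymp)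
  moreover have "\<forall>\<^sub>F x in sequentially. inverse (fact (x + a) / (fact x * real x ^ a)) * (real (x + a) / real x) ^ a
     = fact (x + a - a) * real (x + a) ^ a / fact (x + a)"
    using eventually_gt_at_top[of 0] by eventually_elim (simp add: field_simps)
  ultimately have "(\<lambda>x. fact (x + a - a) * real (x + a) ^ a / fact (x + a)) \<longlonglongrightarrow> 1"
    by (auto intro: Lim_transform_eventually)
  then show ?thesis by (rule LIMSEQ_offset)
qed

text \<open>Repeated halving: \<open>8 * m\<close> splits into two blocks of size
  \<open>4 * m\<close>, each of these into two of size \<open>2 * m\<close>, and two of the
  resulting four into halves of size \<open>m\<close>. The growth is therefore \<open>4\<close> to
  the power \<open>4 * m + 2 * (2 * m) + 2 * m = 10 * m\<close>.\<close>

lemma multinomial_central: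
  "fact (8 * m) / ((fact (2 * m))\<^sup>2 * (fact m) ^ 4) = cb (4 * m) * cb (2 * m) ^ 2 * cb m ^ 2"
proof -
  have e: "2 * (4 * m) = 8 * m" "2 * (2 * m) = 4 * m" by auto
  have nz: "(fact n :: real) \<noteq> 0" for n by simp
  show ?thesis unfolding cb_fact e using nz[of "4 * m"] nz[of "2 * m"] nz[of m]
    by (simp add: divide_simps)
qed


lemma filterlim_mult_at_top: "0 < c \<Longrightarrow> filterlim (\<lambda>m::nat. c * m) at_top at_top"
  by (intro filterlim_subseq strict_monoI) auto

lemma multinomial_asymp:
  assumes \<kappa>: "(\<lambda>n. cb n * sqrt (real n) / 4 ^ n) \<longlonglongrightarrow> \<kappa>"
  shows "(\<lambda>m. fact (8 * m) / ((fact (2 * m))\<^sup>2 * fact m ^ 4) * (real m ^ 2 * sqrt (real m)) / 4 ^ (10 * m))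
    \<longlonglongrightarrow> \<kappa> ^ 5 / 4"
proof -
  let ?b = "\<lambda>n. cb n * sqrt (real n) / 4 ^ n"
  have "(\<lambda>m. ?b (4 * m) * ?b (2 * m) ^ 2 * ?b m ^ 2 / 4) \<longlonglongrightarrow> \<kappa> * \<kappa> ^ 2 * \<kappa> ^ 2 / 4"
    by (intro tendsto_divide tendsto_mult tendsto_power tendsto_const \<kappa>
      filterlim_compose[OF \<kappa> filterlim_mult_at_top]) auto
  moreover have "?b (4 * m) * ?b (2 * m) ^ 2 * ?b m ^ 2 / 4 =
      fact (8 * m) / ((fact (2 * m))\<^sup>2 * fact m ^ 4) * (real m ^ 2 * sqrt (real m)) / 4 ^ (10 * m)" for m
  proof -
    have "(4::real) ^ (10 * m) = 4 ^ (4 * m) * (4 ^ (2 * m)) ^ 2 * (4 ^ m) ^ 2"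
      by (simp flip: power_mult power_add)
    note e1 = this
    have e2: "sqrt (real (4 * m)) * sqrt (real (2 * m)) ^ 2 * sqrt (real m) ^ 2 = 4 * (real m ^ 2 * sqrt (real m))"
      by (simp add: real_sqrt_mult power2_eq_square)
    have "?b (4 * m) * ?b (2 * m) ^ 2 * ?b m ^ 2 / 4 = cb (4 * m) * cb (2 * m) ^ 2 * cb m ^ 2 *
        (sqrt (real (4 * m)) * sqrt (real (2 * m)) ^ 2 * sqrt (real m) ^ 2) /
        (4 ^ (4 * m) * (4 ^ (2 * m)) ^ 2 * (4 ^ m) ^ 2) / 4"
      by (simp only: power_mult_distrib power_divide times_divide_eq_left times_divide_eq_right
        divide_divide_eq_left mult_ac)
    then show ?thesis unfolding e1[symmetric] e2 multinomial_central by simp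
  qed
  ultimately show ?thesis by (simp add: power_numeral_reduce mult_ac)
qed

text \<open>For \<open>r + j \<le> 2 * m\<close> this is the number of arrangements of one marker
  \<open>Mark r j\<close>, \<open>2 * m - (r + j)\<close> letters \<open>L1\<close>,
  \<open>2 * m + j\<close> letters \<open>L2\<close> and \<open>m\<close> of each of the other four.
  The \<open>Suc\<close> accounts for the marker.\<close>

definition shifted_multinomial :: "nat \<Rightarrow> nat \<Rightarrow> nat \<Rightarrow> real" where
  "shifted_multinomial r j m =
     fact (Suc (8 * m - r)) / (fact (2 * m - (r + j)) * fact (2 * m + j) * fact m ^ 4)"

text \<open>Compared with the unshifted coefficient, the shifts contribute
  \<open>(2 * m) ^ (r + j) / ((8 * m) ^ r * (2 * m) ^ j) = 1 / 4 ^ r\<close>, in which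
  \<open>j\<close> cancels. The free position of the marker contributes a factor close to
  \<open>8 * m\<close>, which turns the exponent \<open>- 5/2\<close> of \<open>m\<close> into the
  Catalan exponent \<open>- 3/2\<close>.\<close>

lemma shifted_multinomial_asymp:
  assumes \<kappa>: "(\<lambda>n. cb n * sqrt (real n) / 4 ^ n) \<longlonglongrightarrow> \<kappa>"
  shows "(\<lambda>m. shifted_multinomial r j m * (real m * sqrt (real m)) / 4 ^ (10 * m)) \<longlonglongrightarrow> 2 * \<kappa> ^ 5 / 4 ^ r"
proof -
  define H where "H m = fact (8 * m) / ((fact (2 * m))\<^sup>2 * fact m ^ 4) * (real m ^ 2 * sqrt (real m)) / 4 ^ (10 * m)" for m
  define D1 where "D1 m = fact (8 * m - r) * real (8 * m) ^ r / fact (8 * m)" for m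
  define D2 where "D2 m = fact (2 * m - (r + j)) * real (2 * m) ^ (r + j) / fact (2 * m)" for m
  define D3 where "D3 m = fact (2 * m + j) / (fact (2 * m) * real (2 * m) ^ j)" for m
  have "(\<lambda>m. H m * (D1 m / (D2 m * D3 m)) * ((8 * real m - real r + 1) / real m) / 4 ^ r)
      \<longlonglongrightarrow> \<kappa> ^ 5 / 4 * (1 / (1 * 1)) * 8 / 4 ^ r"
    unfolding H_def D1_def D2_def D3_def
    by (intro tendsto_divide tendsto_mult tendsto_const multinomial_asymp[OF \<kappa>]
      filterlim_compose[OF fact_diff_asymp filterlim_mult_at_top]
      filterlim_compose[OF fact_add_asymp filterlim_mult_at_top]) (auto, real_asymp)
  moreover have "\<forall>\<^sub>F m in sequentially. H m * (D1 m / (D2 m * D3 m)) * ((8 * real m - real r + 1) / real m) / 4 ^ r =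
      shifted_multinomial r j m * (real m * sqrt (real m)) / 4 ^ (10 * m)"
    using eventually_gt_at_top[of r]
  proof eventually_elim
    case (elim m)
    have "(8::real) ^ r = 4 ^ r * 2 ^ r" by (simp flip: power_mult_distrib)
    then have p: "real (8 * m) ^ r = 4 ^ r * real (2 * m) ^ r" by (simp add: power_mult_distrib)
    have f: "(fact (Suc (8 * m - r)) :: real) = (8 * real m - real r + 1) * fact (8 * m - r)"
      using elim by (simp add: of_nat_diff algebra_simps)
    define a b c d e g :: real where "a = fact (8 * m)" and "b = fact (2 * m)" and "c = fact m"
      and "d = fact (8 * m - r)" and "e = fact (2 * m - (r + j))" and "g = fact (2 * m + j)"
    define x y where "x = real (2 * m) ^ r" and "y = real (2 * m) ^ j"
    have nz: "a \<noteq> 0" "b \<noteq> 0" "c \<noteq> 0" "d \<noteq> 0" "e \<noteq> 0" "g \<noteq> 0" "x \<noteq> 0" "y \<noteq> 0" "real m \<noteq> 0"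
      using elim by (auto simp: a_def b_def c_def d_def e_def g_def x_def y_def)
    show ?case
      unfolding H_def D1_def D2_def D3_def shifted_multinomial_def f p power_add
        a_def[symmetric] b_def[symmetric] c_def[symmetric] d_def[symmetric] e_def[symmetric]
        g_def[symmetric] x_def[symmetric] y_def[symmetric]
      using nz by (simp add: field_simps power2_eq_square)
  qed
  ultimately have "(\<lambda>m. shifted_multinomial r j m * (real m * sqrt (real m)) / 4 ^ (10 * m))
      \<longlonglongrightarrow> \<kappa> ^ 5 / 4 * (1 / (1 * 1)) * 8 / 4 ^ r"
    by (rule Lim_transform_eventually)
  then show ?thesis by simp
qed

lemma catalan_asymp:
  assumes \<kappa>: "(\<lambda>n. cb n * sqrt (real n) / 4 ^ n) \<longlonglongrightarrow> \<kappa>"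
  shows "(\<lambda>n. catalan n * (real n * sqrt (real n)) / 4 ^ n) \<longlonglongrightarrow> \<kappa>"
proof -
  have "(\<lambda>n. cb n * sqrt (real n) / 4 ^ n * (real n / (real n + 1))) \<longlonglongrightarrow> \<kappa> * 1"
    by (intro tendsto_mult \<kappa>) real_asymp
  then show ?thesis by (simp add: catalan_def cb_def mult_ac)
qed

text \<open>The factor \<open>1 / 4 ^ r\<close> is absorbed by the index
  \<open>10 * m + (K - r)\<close> of the Catalan number, so the limit is the same for all
  \<open>r\<close> and \<open>j\<close>. The constant \<open>20 * sqrt 10\<close> is twice the limit
  of \<open>(n / m) powr (3/2)\<close> with \<open>n\<close> about \<open>10 * m\<close>.\<close>

lemma shifted_multinomial_over_catalan:
  assumes \<kappa>: "(\<lambda>n. cb n * sqrt (real n) / 4 ^ n) \<longlonglongrightarrow> \<kappa>" "\<kappa> > 0" and "r \<le> K"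
  shows "(\<lambda>m. shifted_multinomial r j m / catalan (10 * m + (K - r))) \<longlonglongrightarrow> 20 * sqrt 10 * \<kappa> ^ 4 / 4 ^ K"
proof -
  define k where "k = K - r"
  have lim: "filterlim (\<lambda>m. 10 * m + k) at_top at_top"
    by (intro filterlim_subseq strict_monoI) auto
  let ?c = "\<lambda>n. catalan n * (real n * sqrt (real n)) / 4 ^ n"
  have "(\<lambda>m. real m / real (10 * m + k)) \<longlonglongrightarrow> 1 / 10" by real_asymp
  then have "(\<lambda>m. ?c (10 * m + k) * (real m / real (10 * m + k) * sqrt (real m / real (10 * m + k))) * 4 ^ k)
      \<longlonglongrightarrow> \<kappa> * (1 / 10 * sqrt (1 / 10)) * 4 ^ k"
    by (intro tendsto_mult tendsto_const tendsto_real_sqrt filterlim_compose[OF catalan_asymp[OF \<kappa>(1)] lim])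
  then have "(\<lambda>m. (shifted_multinomial r j m * (real m * sqrt (real m)) / 4 ^ (10 * m)) /
      (?c (10 * m + k) * (real m / real (10 * m + k) * sqrt (real m / real (10 * m + k))) * 4 ^ k))
      \<longlonglongrightarrow> (2 * \<kappa> ^ 5 / 4 ^ r) / (\<kappa> * (1 / 10 * sqrt (1 / 10)) * 4 ^ k)"
    using \<kappa>(2) by (intro tendsto_divide shifted_multinomial_asymp[OF \<kappa>(1)]) auto
  moreover have "\<forall>\<^sub>F m in sequentially. (shifted_multinomial r j m * (real m * sqrt (real m)) / 4 ^ (10 * m)) /
      (?c (10 * m + k) * (real m / real (10 * m + k) * sqrt (real m / real (10 * m + k))) * 4 ^ k) =
      shifted_multinomial r j m / catalan (10 * m + k)"
    using eventually_gt_at_top[of 0]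
  proof eventually_elim
    case (elim m)
    define u v where "u = real (10 * m + k)" and "v = real m"
    have "sqrt u > 0" "sqrt v > 0" "u > 0" "v > 0" using elim by (auto simp: u_def v_def)
    then show ?case
      unfolding u_def[symmetric] v_def[symmetric] real_sqrt_divide power_add
      by (simp add: divide_simps)
  qed
  moreover have "(2 * \<kappa> ^ 5 / 4 ^ r) / (\<kappa> * (1 / 10 * sqrt (1 / 10)) * 4 ^ k) = 20 * sqrt 10 * \<kappa> ^ 4 / 4 ^ K"
  proof -
    have "(4::real) ^ K = 4 ^ r * 4 ^ k" using assms(3) by (simp add: k_def flip: power_add)
    then show ?thesis using \<kappa>(2) by (simp add: real_sqrt_divide field_simps power_numeral_reduce)
  qed
  ultimately show ?thesis unfolding k_def by (auto intro: Lim_transform_eventually)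
qed

subsection \<open>The alphabet\<close>

lemma log_prime_independent:
  fixes x :: "nat \<Rightarrow> int"
  assumes "finite S" "\<And>p. p \<in> S \<Longrightarrow> prime p" "(\<Sum>p\<in>S. of_int (x p) * log 2 (real p)) = 0" "p \<in> S"
  shows "x p = 0"
proof -
  \<comment> \<open>Splitting the coefficients into positive and negative parts turns the relation
    into an equality of two products of prime powers, to which unique factorisation applies.\<close>
  define u where "u p = nat (x p)" for p
  define v where "v p = nat (- x p)" for p
  have uv: "x p = int (u p) - int (v p)" for p by (auto simp: u_def v_def)
  have log_prod: "log 2 (real (\<Prod>p\<in>S. p ^ w p)) = (\<Sum>p\<in>S. real (w p) * log 2 (real p))" for w
  proof -
    have "ln (\<Prod>p\<in>S. real p ^ w p) = (\<Sum>p\<in>S. ln (real p ^ w p))"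
      using assms(2) by (intro ln_prod assms(1)) (auto simp: prime_gt_0_nat)
    then show ?thesis using assms(2)
      by (simp add: log_def sum_divide_distrib ln_realpow prime_gt_0_nat)
  qed
  have pos: "(\<Prod>p\<in>S. p ^ w p) > 0" for w using assms(2) by (auto simp: prime_gt_0_nat intro!: prod_pos)
  have "(\<Sum>p\<in>S. real (u p) * log 2 (real p)) = (\<Sum>p\<in>S. real (v p) * log 2 (real p))"
    using assms(3) by (simp add: uv algebra_simps sum_subtractf)
  then have "log 2 (real (\<Prod>p\<in>S. p ^ u p)) = log 2 (real (\<Prod>p\<in>S. p ^ v p))"
    unfolding log_prod .
  then have "real (\<Prod>p\<in>S. p ^ u p) = real (\<Prod>p\<in>S. p ^ v p)"
    by (rule inj_onD[OF log_inj[of 2], rotated]) (use pos in \<open>simp_all del: of_nat_prod\<close>)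
  then have "(\<Prod>p\<in>S. p ^ u p) = (\<Prod>p\<in>S. p ^ v p)" by linarith
  then have "multiplicity p (\<Prod>p\<in>S. p ^ u p) = multiplicity p (\<Prod>p\<in>S. p ^ v p)" by simp
  then have "u p = v p" using assms by (simp add: multiplicity_prod_prime_powers)
  then show ?thesis by (simp add: uv)
qed

lemma log_independent:
  fixes x0 x1 x2 x3 x4 x5 x6 :: int
  assumes "of_int x0 + of_int x1 * log 2 (7/4) + of_int x2 * log 2 (5/4) + of_int x3 * log 2 (3/2) +
     of_int x4 * log 2 (11/8) + of_int x5 * log 2 (13/8) + of_int x6 * log 2 (17/16) = 0"
  shows "x0 = 0 \<and> x1 = 0 \<and> x2 = 0 \<and> x3 = 0 \<and> x4 = 0 \<and> x5 = 0 \<and> x6 = 0"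
proof -
  let ?S = "{2, 3, 5, 7, 11, 13, 17} :: nat set"
  \<comment> \<open>Coefficients after expanding the logarithms of the quotients: the prime 2
    collects \<open>x0\<close> and all the denominators.\<close>
  define x :: "nat \<Rightarrow> int" where "x p = (if p = 2 then x0 - 2*x1 - 2*x2 - x3 - 3*x4 - 3*x5 - 4*x6
    else if p = 3 then x3 else if p = 5 then x2 else if p = 7 then x1 else if p = 11 then x4
    else if p = 13 then x5 else x6)" for p
  have l: "log 2 4 = 2" "log 2 8 = 3" "log 2 16 = 4"
    using log_pow_cancel[of 2 2] log_pow_cancel[of 2 3] log_pow_cancel[of 2 4] by simp_all
  have pr: "prime p" if "p \<in> ?S" for p
    using that by auto
  have "(\<Sum>p\<in>?S. of_int (x p) * log 2 (real p)) = 0"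
    using assms by (simp add: x_def log_divide l algebra_simps)
  then have z: "x p = 0" if "p \<in> ?S" for p
    using log_prime_independent[of ?S x p] pr that by blast
  show ?thesis using z[of 2] z[of 3] z[of 5] z[of 7] z[of 11] z[of 13] z[of 17] by (simp add: x_def)
qed


section \<open>Letters and their lengths\<close>

datatype letter = L1 | L2 | L3 | L4 | L5 | L6 | Mark nat nat

text \<open>
  The first five lengths and the constant \<open>log 2 (17/16)\<close> lie between 0 and 1. The sixth length makes
  the sum \<open>2 * L1 + 2 * L2 + L3 + L4 + L5 + L6\<close> of lengths equal to 10. A marker \<open>Mark r j\<close> stands
  for \<open>r + j\<close> occurrences of \<open>L1\<close> and \<open>- j\<close> of \<open>L2\<close>, so there are \<open>r\<close> fewer letters \<open>L1\<close> and
  \<open>L2\<close> in total. Each of them missing divides the number of words by about 4, which the summand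
  \<open>- r\<close> in the length compensates.
\<close>
fun letter_len :: "nat \<Rightarrow> letter \<Rightarrow> real" where
  "letter_len K L1 = log 2 (7/4)"
| "letter_len K L2 = log 2 (5/4)"
| "letter_len K L3 = log 2 (3/2)"
| "letter_len K L4 = log 2 (11/8)"
| "letter_len K L5 = log 2 (13/8)"
| "letter_len K L6 = 10 - 2 * log 2 (7/4) - 2 * log 2 (5/4) - log 2 (3/2) - log 2 (11/8) - log 2 (13/8)"
| "letter_len K (Mark r j) = log 2 (17/16) + real K - real r + real (r + j) * log 2 (7/4) - real j * log 2 (5/4)"

definition alphabet :: "nat \<Rightarrow> letter set" where
  "alphabet N = {L1, L2, L3, L4, L5, L6} \<union> (\<lambda>(r, j). Mark r j) ` ({..<10} \<times> {..<N})"

lemma finite_alphabet: "finite (alphabet N)" by (simp add: alphabet_def)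

text \<open>The length factors through the vector of integer coefficients with respect to 1 and the
  six logarithms. The evaluation \<open>val\<close> is injective by independence, and distinct
  letters have distinct vectors.\<close>

lemma inj_letter_len: "inj (letter_len K)"
proof -
  define val :: "int \<times> int \<times> int \<times> int \<times> int \<times> int \<times> int \<Rightarrow> real" where
    "val = (\<lambda>(x0, x1, x2, x3, x4, x5, x6). of_int x0 + of_int x1 * log 2 (7/4) + of_int x2 * log 2 (5/4)
      + of_int x3 * log 2 (3/2) + of_int x4 * log 2 (11/8) + of_int x5 * log 2 (13/8) + of_int x6 * log 2 (17/16))"
  define vec :: "letter \<Rightarrow> int \<times> int \<times> int \<times> int \<times> int \<times> int \<times> int" where
    "vec = (\<lambda>x. case x of L1 \<Rightarrow> (0,1,0,0,0,0,0) | L2 \<Rightarrow> (0,0,1,0,0,0,0) | L3 \<Rightarrow> (0,0,0,1,0,0,0)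
      | L4 \<Rightarrow> (0,0,0,0,1,0,0) | L5 \<Rightarrow> (0,0,0,0,0,1,0) | L6 \<Rightarrow> (10,-2,-2,-1,-1,-1,0)
      | Mark r j \<Rightarrow> (int K - int r, int r + int j, - int j, 0, 0, 0, 1))"
  have "u = v" if "val u = val v" for u v
  proof -
    obtain x0 x1 x2 x3 x4 x5 x6 where u: "u = (x0, x1, x2, x3, x4, x5, x6)" by (cases u)
    obtain y0 y1 y2 y3 y4 y5 y6 where v: "v = (y0, y1, y2, y3, y4, y5, y6)" by (cases v)
    show ?thesis using that log_independent[of "x0 - y0" "x1 - y1" "x2 - y2" "x3 - y3" "x4 - y4" "x5 - y5" "x6 - y6"]
      by (simp add: u v val_def algebra_simps)
  qed
  then have "inj val" by (rule injI)
  moreover have "inj vec" by (rule injI) (auto simp: vec_def split: letter.splits)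
  moreover have "letter_len K x = val (vec x)" for x
    by (cases x) (simp_all add: val_def vec_def algebra_simps)
  then have "letter_len K = val \<circ> vec" by auto
  ultimately show ?thesis by (simp add: inj_compose)
qed

text \<open>For \<open>L6\<close>, seven logarithms below 1 are subtracted from 10. For a marker,
  \<open>r \<le> K\<close>, and the negative term is dominated because \<open>log 2 (5/4)\<close> is
  at most \<open>log 2 (7/4)\<close>.\<close>

lemma letter_len_pos:
  assumes "10 \<le> K" "x \<in> alphabet N"
  shows "0 < letter_len K x"
proof -
  have lt1: "log 2 (7/4) < (1::real)" "log 2 (5/4) < (1::real)" "log 2 (3/2) < (1::real)"
    "log 2 (11/8) < (1::real)" "log 2 (13/8) < (1::real)" by simp_all
  show ?thesis
  proof (cases x)
    case (Mark r j)
    then have "r \<le> K" using assms by (auto simp: alphabet_def)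
    moreover have "real j * log 2 (5/4) \<le> real (r + j) * log 2 (7/4)"
      by (intro mult_mono) auto
    moreover have "0 < log 2 (17/16::real)" by simp
    ultimately show ?thesis unfolding Mark letter_len.simps by linarith
  next
    case L6
    show ?thesis unfolding L6 letter_len.simps using lt1 by linarith
  qed simp_all
qed

section \<open>Letter contents of words of a given length\<close>

lemma sum_mset_count:
  assumes "finite S" "set_mset A \<subseteq> S"
  shows "(\<Sum>x\<in>#A. f x) = (\<Sum>x\<in>S. real (count A x) * f x)"
  using assms(2)
proof (induction A)
  case (add y A)
  have "(\<Sum>x\<in>S. real (count (add_mset y A) x) * f x) = (\<Sum>x\<in>S. real (count A x) * f x + (if x = y then f y else 0))"
    by (intro sum.cong) (auto simp: algebra_simps)
  also have "\<dots> = (\<Sum>x\<in>S. real (count A x) * f x) + f y"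
    using add.prems assms(1) by (simp add: sum.distrib)
  finally show ?case using add by simp
qed simp

definition word_mset :: "nat \<Rightarrow> nat \<Rightarrow> nat \<Rightarrow> letter multiset" where
  "word_mset r j m = add_mset (Mark r j) (replicate_mset (2 * m - (r + j)) L1 + replicate_mset (2 * m + j) L2 +
     replicate_mset m L3 + replicate_mset m L4 + replicate_mset m L5 + replicate_mset m L6)"

text \<open>By the choice of \<open>L6\<close>, the balanced multiset has length
  \<open>10 * m\<close>. The logarithms in the marker cancel the \<open>r + j\<close> missing
  letters \<open>L1\<close> and the \<open>j\<close> additional letters \<open>L2\<close>.\<close>

lemma sum_letter_len_word_mset:
  assumes "r + j \<le> 2 * m" "r \<le> K"
  shows "(\<Sum>x\<in>#word_mset r j m. letter_len K x) = real (10 * m + (K - r)) + log 2 (17/16)"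
  using assms by (simp add: word_mset_def of_nat_diff algebra_simps)

text \<open>Comparing coefficients in the length equation: that of \<open>log 2 (17/16)\<close>
  forces exactly one marker, those of the logarithms of 3/2, 11/8 and 13/8 force \<open>L3\<close>,
  \<open>L4\<close>, \<open>L5\<close> to occur as often as \<open>L6\<close>, and the remaining
  ones determine \<open>L1\<close>, \<open>L2\<close> and \<open>n\<close>.\<close>

lemma word_mset_complete:
  assumes "set_mset A \<subseteq> alphabet N" "(\<Sum>x\<in>#A. letter_len K x) = real n + log 2 (17/16)" "10 \<le> K"
  obtains r j m where "r < 10" "j < N" "r + j \<le> 2 * m" "n = 10 * m + (K - r)" "A = word_mset r j m"
proof -
  define k where "k = (\<lambda>x. int (count A x))"
  let ?M = "{..<10} \<times> {..<N}"
  define c where "c = (\<lambda>(r, j). count A (Mark r j))"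
  \<comment> \<open>\<open>sc g\<close> is the sum of \<open>g\<close> over all markers in
    \<open>A\<close>, with multiplicity.\<close>
  define sc :: "(nat \<times> nat \<Rightarrow> int) \<Rightarrow> int" where "sc g = (\<Sum>q\<in>?M. int (c q) * g q)" for g
  have inj: "inj_on (\<lambda>(r, j). Mark r j) ?M" by (auto simp: inj_on_def)
  have "real n + log 2 (17/16) = (\<Sum>x\<in>alphabet N. real (count A x) * letter_len K x)"
    using sum_mset_count[OF finite_alphabet assms(1), of "letter_len K"] assms(2) by simp
  also have "\<dots> = (\<Sum>x\<in>{L1, L2, L3, L4, L5, L6}. real (count A x) * letter_len K x) +
      (\<Sum>x\<in>(\<lambda>(r, j). Mark r j) ` ?M. real (count A x) * letter_len K x)"
    unfolding alphabet_def by (intro sum.union_disjoint) auto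
  also have "(\<Sum>x\<in>(\<lambda>(r, j). Mark r j) ` ?M. real (count A x) * letter_len K x) =
      (\<Sum>(r, j)\<in>?M. real (c (r, j)) * letter_len K (Mark r j))"
    by (subst sum.reindex[OF inj]) (auto simp: c_def intro!: sum.cong)
  also have "\<dots> = (\<Sum>q\<in>?M. of_int (int (c q) * 1) * log 2 (17/16) + of_int (int (c q) * (int K - int (fst q)))
      + of_int (int (c q) * (int (fst q) + int (snd q))) * log 2 (7/4) - of_int (int (c q) * int (snd q)) * log 2 (5/4))"
    by (intro sum.cong) (auto simp: algebra_simps)
  also have "\<dots> = of_int (sc (\<lambda>q. 1)) * log 2 (17/16) + of_int (sc (\<lambda>q. int K - int (fst q)))
      + of_int (sc (\<lambda>q. int (fst q) + int (snd q))) * log 2 (7/4) - of_int (sc (\<lambda>q. int (snd q))) * log 2 (5/4)"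
    unfolding sc_def of_int_sum sum_distrib_right by (simp only: sum.distrib sum_subtractf)
  finally have "of_int (10 * k L6 + sc (\<lambda>q. int K - int (fst q)) - int n)
      + of_int (k L1 - 2 * k L6 + sc (\<lambda>q. int (fst q) + int (snd q))) * log 2 (7/4)
      + of_int (k L2 - 2 * k L6 - sc (\<lambda>q. int (snd q))) * log 2 (5/4)
      + of_int (k L3 - k L6) * log 2 (3/2) + of_int (k L4 - k L6) * log 2 (11/8)
      + of_int (k L5 - k L6) * log 2 (13/8) + of_int (sc (\<lambda>q. 1) - 1) * log 2 (17/16) = 0"
    by (simp add: k_def algebra_simps)
  from log_independent[OF this]
  have eqs: "10 * k L6 + sc (\<lambda>q. int K - int (fst q)) = int n"
    "k L1 = 2 * k L6 - sc (\<lambda>q. int (fst q) + int (snd q))"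
    "k L2 = 2 * k L6 + sc (\<lambda>q. int (snd q))" "k L3 = k L6" "k L4 = k L6" "k L5 = k L6" "sc (\<lambda>q. 1) = 1"
    by auto
  have "int (\<Sum>q\<in>?M. c q) = 1" using eqs(7) by (simp add: sc_def)
  then have "(\<Sum>q\<in>?M. c q) = 1" by linarith
  then have "\<exists>q\<in>?M. c q = 1 \<and> (\<forall>p\<in>?M. q \<noteq> p \<longrightarrow> c p = 0)"
    using sum_eq_1_iff[of ?M c] by (metis One_nat_def finite_cartesian_product finite_lessThan)
  then obtain q where q12: "q \<in> ?M" "c q = 1 \<and> (\<forall>p\<in>?M. q \<noteq> p \<longrightarrow> c p = 0)"
    by (rule bexE)
  have q: "q \<in> ?M" "c q = 1" "\<And>p. p \<in> ?M \<Longrightarrow> q \<noteq> p \<Longrightarrow> c p = 0"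
    using q12(1) conjunct1[OF q12(2)] bspec[OF conjunct2[OF q12(2)]] by simp_all
  obtain r j where rj: "q = (r, j)" by (cases q)
  have sc: "sc g = g q" for g
  proof -
    have "sc g = (\<Sum>p\<in>?M. if p = q then g q else 0)"
      unfolding sc_def using q by (intro sum.cong) auto
    then show ?thesis using q by simp
  qed
  define m where "m = count A L6"
  \<comment> \<open>The bound \<open>r + j \<le> 2 * m\<close> comes from the equation for
    \<open>L1\<close>, as a multiplicity is nonnegative.\<close>
  have counts: "count A L6 = m" "count A L3 = m" "count A L4 = m" "count A L5 = m" "r + j \<le> 2 * m"
    "count A L1 = 2 * m - (r + j)" "count A L2 = 2 * m + j" "n = 10 * m + (K - r)"
    using eqs(1-6) q(1) assms(3) unfolding sc rj k_def m_def by auto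
  have "A = word_mset r j m"
  proof (rule multiset_eqI)
    fix x
    show "count A x = count (word_mset r j m) x"
    proof (cases x)
      case (Mark r' j')
      show ?thesis
      proof (cases "(r', j') \<in> ?M")
        case True
        then show ?thesis using q(2) q(3)[OF True] Mark by (auto simp: rj c_def word_mset_def)
      next
        case False
        then have "x \<notin> alphabet N" using Mark by (auto simp: alphabet_def)
        then have "count A x = 0" using assms(1) by (meson count_eq_zero_iff subsetD)
        moreover have "(r', j') \<noteq> (r, j)" using False q(1) rj by auto
        ultimately show ?thesis using Mark by (auto simp: word_mset_def)
      qed
    qed (simp_all add: counts word_mset_def)
  qed
  with q(1) counts show thesis by (intro that[of r j m]) (auto simp: rj)
qed

lemma card_permutations_word_mset:
  assumes "r + j \<le> 2 * m"
  shows "real (card (permutations_of_multiset (word_mset r j m))) = shifted_multinomial r j m"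
proof -
  let ?A = "word_mset r j m"
  \<comment> \<open>Some multiplicities may be 0; since \<open>fact 0 = 1\<close>, the product can
    run over all seven letters.\<close>
  have "(\<Prod>x\<in>set_mset ?A. fact (count ?A x)) = (\<Prod>x\<in>{L1, L2, L3, L4, L5, L6, Mark r j}. fact (count ?A x) :: nat)"
    by (intro prod.mono_neutral_left) (auto simp: word_mset_def split: if_splits)
  also have "\<dots> = fact (2 * m - (r + j)) * fact (2 * m + j) * fact m ^ 4"
    by (simp add: word_mset_def power4_eq_xxxx mult_ac)
  finally have p: "(\<Prod>x\<in>set_mset ?A. fact (count ?A x)) = (fact (2 * m - (r + j)) * fact (2 * m + j) * fact m ^ 4 :: nat)" .
  have "size ?A = Suc (8 * m - r)" using assms by (simp add: word_mset_def)
  then have "card (permutations_of_multiset ?A) * (fact (2 * m - (r + j)) * fact (2 * m + j) * fact m ^ 4) = fact (Suc (8 * m - r))"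
    using card_permutations_of_multiset_aux[of ?A] unfolding p by simp
  then have "real (card (permutations_of_multiset ?A) * (fact (2 * m - (r + j)) * fact (2 * m + j) * fact m ^ 4)) =
      real (fact (Suc (8 * m - r)))" by (simp only:)
  then show ?thesis unfolding shifted_multinomial_def
    by (simp only: of_nat_mult of_nat_power of_nat_fact) (simp add: field_simps)
qed

text \<open>The words are the permutations of the multisets \<open>word_mset r j m\<close> with
  \<open>j < N\<close>: the total length fixes \<open>r\<close> and \<open>m\<close>, while
  \<open>j\<close> stays free. The bound \<open>r + N \<le> 2 * m\<close> guarantees that every such
  \<open>j\<close> occurs.\<close>

lemma card_words_letters:
  assumes "10 \<le> K" "r < 10" "r + N \<le> 2 * m"
  shows "real (card (words (letter_len K ` alphabet N) (real (10 * m + (K - r)) + log 2 (17/16)))) =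
    (\<Sum>j<N. shifted_multinomial r j m)"
proof -
  let ?a = "real (10 * m + (K - r)) + log 2 (17/16)"
  define W where "W = (\<Union>j<N. permutations_of_multiset (word_mset r j m))"
  have inj: "inj (map (letter_len K))" using inj_letter_len by (rule inj_mapI)
  have len: "sum_list (map (letter_len K) xs) = (\<Sum>x\<in>#mset xs. letter_len K x)" for xs
    by (simp flip: sum_mset_sum_list)
  have sub: "set_mset (word_mset r j m) \<subseteq> alphabet N" if "j < N" for j
    using assms(2) that by (auto simp: word_mset_def alphabet_def split: if_splits)
  have "words (letter_len K ` alphabet N) ?a = map (letter_len K) ` W"
  proof (intro equalityI subsetI)
    fix ys assume ys: "ys \<in> words (letter_len K ` alphabet N) ?a"
    then have "ys \<in> lists (letter_len K ` alphabet N)" by (auto simp: words_def)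
    then obtain xs where xs: "ys = map (letter_len K) xs" "set xs \<subseteq> alphabet N"
      by (auto simp: lists_image)
    have "(\<Sum>x\<in>#mset xs. letter_len K x) = real (10 * m + (K - r)) + log 2 (17/16)"
      using ys by (simp add: words_def xs len)
    moreover have "set_mset (mset xs) \<subseteq> alphabet N" using xs by simp
    ultimately obtain r' j' m' where A: "r' < 10" "j' < N" "10 * m + (K - r) = 10 * m' + (K - r')"
      "mset xs = word_mset r' j' m'"
      using assms(1) by (metis word_mset_complete)
    \<comment> \<open>Both \<open>r\<close> and \<open>r'\<close> are below 10, so reduction modulo
      10 identifies them and then \<open>m\<close> with \<open>m'\<close>.\<close>
    have "10 * m + r' = 10 * m' + r" using A(1,3) assms(1,2) by linarith
    moreover from arg_cong[OF this, of "\<lambda>x. x mod 10"] have "r' = r" using A(1) assms(2) by simp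
    ultimately have "r' = r \<and> m' = m" by simp
    then have "xs \<in> W" using A by (auto simp: W_def permutations_of_multiset_def)
    then show "ys \<in> map (letter_len K) ` W" using xs by simp
  next
    fix ys assume "ys \<in> map (letter_len K) ` W"
    then obtain xs j where xs: "ys = map (letter_len K) xs" "j < N" "mset xs = word_mset r j m"
      by (auto simp: W_def permutations_of_multiset_def)
    then have "set xs \<subseteq> alphabet N" using sub by (metis set_mset_mset)
    moreover have "sum_list ys = ?a"
      unfolding xs(1) len xs(3) using assms xs(2) by (intro sum_letter_len_word_mset) auto
    ultimately show "ys \<in> words (letter_len K ` alphabet N) ?a"
      by (auto simp: words_def xs(1))
  qed
  then have "card (words (letter_len K ` alphabet N) ?a) = card W"
    using card_image[OF inj_on_subset[OF inj subset_UNIV], of W] by simp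
  also have "\<dots> = (\<Sum>j<N. card (permutations_of_multiset (word_mset r j m)))"
    unfolding W_def
  proof (intro card_UN_disjoint ballI impI)
    fix i j :: nat assume "i \<noteq> j"
    then have "count (word_mset r i m) (Mark r i) \<noteq> count (word_mset r j m) (Mark r i)"
      by (auto simp: word_mset_def)
    then have "word_mset r i m \<noteq> word_mset r j m" by auto
    then show "permutations_of_multiset (word_mset r i m) \<inter> permutations_of_multiset (word_mset r j m) = {}"
      by (auto simp: permutations_of_multiset_def)
  qed auto
  finally show ?thesis using assms(3) by (simp add: card_permutations_word_mset)
qed

section \<open>Combining the residue classes\<close>

lemma LIMSEQ_residues:
  fixes f :: "nat \<Rightarrow> 'a :: topological_space"
  assumes "\<And>r. r < d \<Longrightarrow> (\<lambda>m. f (d * m + (K - r))) \<longlonglongrightarrow> l" "0 < d" "d \<le> K"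
  shows "f \<longlonglongrightarrow> l"
proof (rule topological_tendstoI)
  fix S assume S: "open S" "l \<in> S"
  have "\<forall>\<^sub>F m in sequentially. \<forall>r\<in>{..<d}. f (d * m + (K - r)) \<in> S"
    using assms(1) S by (intro eventually_ball_finite ballI topological_tendstoD) auto
  then obtain m0 where m0: "\<And>m r. m0 \<le> m \<Longrightarrow> r < d \<Longrightarrow> f (d * m + (K - r)) \<in> S"
    by (auto simp: eventually_sequentially)
  have "f n \<in> S" if "n \<ge> d * m0 + K" for n
  proof -
    \<comment> \<open>The offsets \<open>K - r\<close> run from \<open>K - (d - 1)\<close> to
      \<open>K\<close>, hence \<open>n - K\<close> is divided by \<open>d\<close> with rounding up,
      and \<open>r = d - 1 - s\<close> is the excess.\<close>
    define m where "m = (n - K + (d - 1)) div d"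
    define s where "s = (n - K + (d - 1)) mod d"
    have sm: "n - K + (d - 1) = d * m + s" "s < d" using assms(2) by (auto simp: m_def s_def)
    have "d * m0 \<le> n - K + (d - 1)" using that assms by linarith
    then have "m0 \<le> m" using assms(2) by (simp add: m_def less_eq_div_iff_mult_less_eq mult.commute)
    moreover have "n = d * m + (K - (d - 1 - s))" using sm that assms by linarith
    ultimately show ?thesis using m0[of m "d - 1 - s"] assms(2) by simp
  qed
  then show "\<forall>\<^sub>F n in sequentially. f n \<in> S" by (auto simp: eventually_sequentially)
qed

theorem proposition4p7:
  fixes \<epsilon> :: real
  assumes "\<epsilon> > 0"
  shows "\<exists>f \<in> tile_counting_functions. \<exists>A \<in> {1 - \<epsilon><..<1 + \<epsilon>}.
           (\<lambda>n. real (f n) / (A * catalan n)) \<longlonglongrightarrow> 1"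
proof -
  obtain \<kappa> where \<kappa>: "\<kappa> > 0" "(\<lambda>n. cb n * sqrt (real n) / 4 ^ n) \<longlonglongrightarrow> \<kappa>"
    by (rule central_binomial_asymp)
  define B where "B = 20 * sqrt 10 * \<kappa> ^ 4"
  have B: "B > 0" using \<kappa> by (simp add: B_def)
  \<comment> \<open>Capping at 1 ensures \<open>A > 0\<close> below.\<close>
  define \<delta> where "\<delta> = min \<epsilon> 1"
  have \<delta>: "0 < \<delta>" "\<delta> \<le> \<epsilon>" "\<delta> \<le> 1" using assms by (auto simp: \<delta>_def)
  have "(\<lambda>K. B / 4 ^ K) \<longlonglongrightarrow> 0" by real_asymp
  then have "\<forall>\<^sub>F K in sequentially. B / 4 ^ K < \<delta>" using \<delta>(1) by (rule order_tendstoD)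
  then have "\<forall>\<^sub>F K in sequentially. B / 4 ^ K < \<delta> \<and> 10 \<le> K"
    using eventually_ge_at_top[of 10] by eventually_elim auto
  then obtain K where K: "B / 4 ^ K < \<delta>" "10 \<le> K"
    using eventually_happens trivial_limit_sequentially by blast
  define b where "b = B / 4 ^ K"
  have b: "0 < b" "b < \<delta>" using B K by (auto simp: b_def)
  \<comment> \<open>One marker contributes \<open>b\<close> to the limit. With \<open>N\<close>
    markers per class, \<open>A\<close> is the largest multiple of \<open>b\<close> not exceeding 1,
    hence within \<open>b < \<delta>\<close> of it.\<close>
  define N where "N = nat \<lfloor>1 / b\<rfloor>"
  define A where "A = real N * b"
  have N: "real N \<le> 1 / b" "1 / b < real N + 1" using b by (auto simp: N_def)
  have A: "1 - \<delta> < A" "A \<le> 1" using N b by (auto simp: A_def field_simps)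
  have "A > 0" using A \<delta> by simp
  define L where "L = letter_len K ` alphabet N"
  have L: "finite L" "\<And>l. l \<in> L \<Longrightarrow> 0 < l"
    using finite_alphabet letter_len_pos[OF K(2)] by (auto simp: L_def)
  define \<theta> :: real where "\<theta> = log 2 (17/16)"
  have "\<theta> > 0" by (simp add: \<theta>_def)
  define f where "f = tile_count (strip ` L) \<theta>"
  have "f \<in> tile_counting_functions"
    unfolding tile_counting_functions_def f_def using L tile_strip tall_strip \<open>\<theta> > 0\<close>
    by (intro CollectI exI[of _ "strip ` L"] exI[of _ \<theta>]) auto
  moreover have "A \<in> {1 - \<epsilon><..<1 + \<epsilon>}" using A \<delta> assms by auto
  moreover have "(\<lambda>n. real (f n) / (A * catalan n)) \<longlonglongrightarrow> 1"
  proof (rule LIMSEQ_residues[of 10 _ K])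
    fix r :: nat assume r: "r < 10"
    \<comment> \<open>Each of the \<open>N\<close> summands tends to \<open>b\<close> whatever
      \<open>r\<close> is, so every residue class has the limit
      \<open>N * b / A = 1\<close>.\<close>
    have "(\<lambda>m. (\<Sum>j<N. shifted_multinomial r j m / catalan (10 * m + (K - r))) / A) \<longlonglongrightarrow> (\<Sum>j<N. b) / A"
      unfolding b_def B_def using \<kappa> r K \<open>A > 0\<close>
      by (intro tendsto_divide tendsto_sum tendsto_const shifted_multinomial_over_catalan) auto
    moreover have "\<forall>\<^sub>F m in sequentially. (\<Sum>j<N. shifted_multinomial r j m / catalan (10 * m + (K - r))) / A =
        real (f (10 * m + (K - r))) / (A * catalan (10 * m + (K - r)))"
      using eventually_ge_at_top[of "r + N"]
    proof eventually_elim
      case (elim m)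
      have "real (f (10 * m + (K - r))) = (\<Sum>j<N. shifted_multinomial r j m)"
      proof -
        have "0 < real (10 * m + (K - r)) + \<theta>" using \<open>\<theta> > 0\<close> by (rule add_nonneg_pos[OF of_nat_0_le_iff])
        then have "f (10 * m + (K - r)) = card (words L (real (10 * m + (K - r)) + \<theta>))"
          unfolding f_def tile_count_def using L by (intro card_tilings_strips) auto
        moreover have "r + N \<le> 2 * m" using elim by simp
        ultimately show ?thesis using card_words_letters[OF K(2) r] unfolding L_def \<theta>_def by metis
      qed
      then show ?case by (simp add: mult.commute flip: sum_divide_distrib)
    qed
    ultimately have "(\<lambda>m. real (f (10 * m + (K - r))) / (A * catalan (10 * m + (K - r)))) \<longlonglongrightarrow> (\<Sum>j<N. b) / A"
      by (rule Lim_transform_eventually)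
    then show "(\<lambda>m. real (f (10 * m + (K - r))) / (A * catalan (10 * m + (K - r)))) \<longlonglongrightarrow> 1"
      using \<open>A > 0\<close> by (simp flip: A_def)
  qed (use K in auto)
  ultimately show ?thesis by blast
qed

end
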